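(* Let $N\ge 2$ be an integer, let $V>g>0$ be real numbers, and let $r_1,r_2\in[0,1]$ with at least one of $r_1,r_2$ nonzero. Then the unique symmetric mixed-strategy Nash equilibrium of the auction game is given by $\beta_i=(p^*,F^* )$ for every agent $i\in[N]$, where $$p^*=\left(\frac{r_1g}{V-g+r_1g}\right)^{\frac1{N-1}},\qquad F^*(b)=\frac{1}{1-p^*}\left(\left(\frac{r_1g+r_2b}{V-g-b+r_1g+r_2b}\right)^{\frac{1}{N-1}}-p^*\right)\quad\text{for } b\in[0,V-g].$$ The expected payoff of every agent in this equilibrium is zero.
   Context: Auction game with mixed strategies. $N\ge2$ agents $i\in[N]=\{1,\dots,N\}$ compete for a single opportunity of common value $V>0$; $g>0$ is the base fee, with $V>g$; $r_1,r_2\in[0,1]$ are the revert penalty rates on the base fee and the priority fee. A mixed strategy of agent $i$ is a pair $\beta_i=(p_i,F_i)$, where $p_i\in[0,1]$ is the probability of abstaining (action $b_i=\varnothing$) and $F_i$ is a continuous cumulative distribution function supported on $[0,\infty)$, the distribution of agent $i$'s bid $b_i\ge 0$ conditional on participating. Agents randomize independently. The highest participating bid wins (ties have probability zero). Given the other agents' strategies $\beta_{-i}$, an agent $i$ bidding $b_i\ge0$ wins with probability $$\mathbb P(w=i\mid b_i,\beta_{-i})=\prod_{j\ne i}\bigl(p_j+(1-p_j)F_j(b_i)\bigr)$$ and has payoff $$u_i(b_i\mid\beta_{-i})=(V-g-b_i)\,\mathbb P(w=i\mid b_i,\beta_{-i})-(r_1g+r_2b_i)\bigl(1-\mathbb P(w=i\mid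 b_i,\beta_{-i})\bigr);$$ abstaining gives payoff $0$. The expected payoff is $\bar u_i(\beta_i,\beta_{-i})=(1-p_i)\int_0^\infty u_i(b\mid\beta_{-i})\,dF_i(b)$. A profile $\beta^*$ is a mixed-strategy Nash equilibrium if $\bar u_i(\beta_i^*,\beta_{-i}^* )\ge\bar u_i(\beta_i,\beta_{-i}^* )$ for all $i$ and all mixed strategies $\beta_i$. It is symmetric if all $\beta_i^*$ are identical. The formula for $F^*$ on $[0,V-g]$ specifies a cdf with $F^*(0)=0$ and $F^*(V-g)=1$, so it is extended by $1$ above $V-g$. *)

theory Defs
  imports "HOL-Probability.Probability"
begin

text \<open>A mixed strategy \<open>(p, F)\<close>: the probability \<open>p\<close> of abstaining, and the cdf \<open>F\<close> of the
  bid conditional on participating.\<close>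

type_synonym strategy = "real \<times> (real \<Rightarrow> real)"

definition mixed_strategy :: "strategy \<Rightarrow> bool" where
  "mixed_strategy s \<longleftrightarrow> (case s of (p, F) \<Rightarrow>
     0 \<le> p \<and> p \<le> 1 \<and> continuous_on UNIV F \<and>
     (\<exists>M. real_distribution M \<and> measure M {0..} = 1 \<and> F = cdf M))"

text \<open>The agents are \<open>1, \<dots>, N\<close>; only the values of a profile \<open>\<beta>\<close> on \<open>{1..N}\<close> matter.\<close>

definition win_prob :: "nat \<Rightarrow> (nat \<Rightarrow> strategy) \<Rightarrow> nat \<Rightarrow> real \<Rightarrow> real" where
  "win_prob N \<beta> i b =
     (\<Prod>j\<in>{1..N} - {i}. fst (\<beta> j) + (1 - fst (\<beta> j)) * snd (\<beta> j) b)"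

definition payoff ::
    "nat \<Rightarrow> real \<Rightarrow> real \<Rightarrow> real \<Rightarrow> real \<Rightarrow> (nat \<Rightarrow> strategy) \<Rightarrow> nat \<Rightarrow> real \<Rightarrow> real" where
  "payoff N V g r1 r2 \<beta> i b =
     (V - g - b) * win_prob N \<beta> i b - (r1 * g + r2 * b) * (1 - win_prob N \<beta> i b)"

text \<open>Expected payoff of agent \<open>i\<close> playing \<open>s\<close> against the strategies \<open>\<beta> j\<close> of the agents
  \<open>j \<noteq> i\<close>. On \<open>[0, \<infinity>)\<close> the payoff is bounded above by \<open>V - g\<close> but unbounded below, so its
  integral exists in \<open>[-\<infinity>, \<infinity>)\<close>, and is \<open>-\<infinity>\<close> for some cdfs of infinite mean. It is therefore
  formed in \<^typ>\<open>ereal\<close> as the difference of the integrals of the positive and negative parts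
  (\<^const>\<open>ennreal\<close> truncates negative numbers to \<open>0\<close>); the Bochner integral would assign the
  value \<open>0\<close> to such a cdf. For \<open>p = 1\<close> the product is \<open>0\<close>.\<close>

definition expected_payoff ::
    "nat \<Rightarrow> real \<Rightarrow> real \<Rightarrow> real \<Rightarrow> real \<Rightarrow> nat \<Rightarrow> strategy \<Rightarrow> (nat \<Rightarrow> strategy) \<Rightarrow> ereal" where
  "expected_payoff N V g r1 r2 i s \<beta> = ereal (1 - fst s) *
     (enn2ereal (\<integral>\<^sup>+b\<in>{0..}. ennreal (payoff N V g r1 r2 \<beta> i b) \<partial>interval_measure (snd s))
      - enn2ereal (\<integral>\<^sup>+b\<in>{0..}. ennreal (- payoff N V g r1 r2 \<beta> i b) \<partial>interval_measure (snd s)))"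

definition nash_equilibrium ::
    "nat \<Rightarrow> real \<Rightarrow> real \<Rightarrow> real \<Rightarrow> real \<Rightarrow> (nat \<Rightarrow> strategy) \<Rightarrow> bool" where
  "nash_equilibrium N V g r1 r2 \<beta> \<longleftrightarrow>
     (\<forall>i\<in>{1..N}. mixed_strategy (\<beta> i)) \<and>
     (\<forall>i\<in>{1..N}. \<forall>s. mixed_strategy s \<longrightarrow>
        expected_payoff N V g r1 r2 i (\<beta> i) \<beta> \<ge> expected_payoff N V g r1 r2 i s \<beta>)"

definition symmetric_profile :: "nat \<Rightarrow> (nat \<Rightarrow> strategy) \<Rightarrow> bool" where
  "symmetric_profile N \<beta> \<longleftrightarrow> (\<forall>i\<in>{1..N}. \<forall>j\<in>{1..N}. \<beta> i = \<beta> j)"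

definition p_star :: "nat \<Rightarrow> real \<Rightarrow> real \<Rightarrow> real \<Rightarrow> real" where
  "p_star N V g r1 = (r1 * g / (V - g + r1 * g)) powr (1 / (real N - 1))"

definition F_star :: "nat \<Rightarrow> real \<Rightarrow> real \<Rightarrow> real \<Rightarrow> real \<Rightarrow> real \<Rightarrow> real" where
  "F_star N V g r1 r2 b =
     (if b < 0 then 0
      else if b \<le> V - g then
        1 / (1 - p_star N V g r1) *
          (((r1 * g + r2 * b) / (V - g - b + r1 * g + r2 * b)) powr (1 / (real N - 1))
           - p_star N V g r1)
      else 1)"

end

theory Submission imports Defs begin

text \<open>Write \<open>u\<close> for the payoff of a bid against \<open>N - 1\<close> copies of \<open>(p, F)\<close>. In a symmetric
  equilibrium of value \<open>m\<close>, deviations to nearly pure bids give \<open>u \<le> m\<close> on \<open>[0, \<infinity>)\<close>, hence \<open>u = m\<close>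
  almost surely under \<open>F\<close>. If \<open>p > 0\<close>, indifference to abstaining forces \<open>m = 0\<close>; if \<open>p = 0\<close>, the lowest
  bid in the support never wins and so does not earn a positive payoff, again \<open>m = 0\<close>. Now \<open>u \<le> 0\<close> says
  that the winning probability \<open>W\<close> is at most the break-even probability \<open>odds\<close>
  on \<open>[0, V - g]\<close>. If \<open>W b < odds b\<close>, the next bid \<open>c \<ge> b\<close> with \<open>u c = 0\<close> has \<open>W c = W b\<close>, because \<open>F\<close>
  puts no mass on \<open>[b, c]\<close>; this contradicts \<open>W c = odds c \<ge> odds b\<close>. So \<open>W = odds\<close>, which determines
  \<open>p\<close> (at \<open>b = 0\<close>) and then \<open>F\<close>.\<close>

section \<open>Expectations with values in the extended reals\<close>

text \<open>The bracket in \<open>expected_payoff\<close>, isolated so that it can be studied for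
  any measure and integrand.\<close>

definition ext_mean :: "real measure \<Rightarrow> (real \<Rightarrow> real) \<Rightarrow> ereal" where
  "ext_mean M u = enn2ereal (\<integral>\<^sup>+x\<in>{0..}. ennreal (u x) \<partial>M)
                - enn2ereal (\<integral>\<^sup>+x\<in>{0..}. ennreal (- u x) \<partial>M)"

lemma nn_set_integral_AE:
  assumes "AE x in M. 0 \<le> (x::real)"
  shows "(\<integral>\<^sup>+x\<in>{0..}. f x \<partial>M) = (\<integral>\<^sup>+x. f x \<partial>M)"
  by (rule nn_integral_cong_AE) (use assms in \<open>auto simp: indicator_def\<close>)

lemma ext_mean_integrable:
  assumes "integrable M u" and "AE x in M. 0 \<le> x"
  shows "ext_mean M u = ereal (\<integral>x. u x \<partial>M)"
proof -
  have fin: "(\<integral>\<^sup>+x. ennreal (u x) \<partial>M) \<noteq> \<infinity>" "(\<integral>\<^sup>+x. ennreal (- u x) \<partial>M) \<noteq> \<infinity>"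
    using assms(1) by (auto simp: real_integrable_def)
  have "enn2ereal y = ereal (enn2real y)" if "y \<noteq> \<infinity>" for y
    using that by (cases y) auto
  then show ?thesis
    using fin assms(2)
    by (simp add: ext_mean_def nn_set_integral_AE real_lebesgue_integral_def[OF assms(1)])
qed

text \<open>The bound \<open>K\<close> keeps the integral of the positive part finite, so a
  divergent negative part would force the value minus infinity.\<close>

lemma (in real_distribution) integrable_of_ext_mean:
  assumes "u \<in> borel_measurable M" and "AE x in M. 0 \<le> x"
    and "\<And>x. 0 \<le> x \<Longrightarrow> u x \<le> K" and "ext_mean M u \<noteq> -\<infinity>"
  shows "integrable M u"
proof -
  have "(\<integral>\<^sup>+x. ennreal (u x) \<partial>M) \<le> (\<integral>\<^sup>+x. ennreal K \<partial>M)"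
    by (rule nn_integral_mono_AE) (use assms(2,3) in \<open>auto intro: ennreal_leI\<close>)
  also have "\<dots> < \<infinity>"
    using emeasure_space_1 by simp
  finally have pos: "(\<integral>\<^sup>+x. ennreal (u x) \<partial>M) \<noteq> \<infinity>" by simp
  then obtain r where "(\<integral>\<^sup>+x. ennreal (u x) \<partial>M) = ennreal r" "0 \<le> r"
    by (cases "\<integral>\<^sup>+x. ennreal (u x) \<partial>M") auto
  then have "(\<integral>\<^sup>+x. ennreal (- u x) \<partial>M) \<noteq> \<infinity>"
    using assms(2,4) by (auto simp: ext_mean_def nn_set_integral_AE)
  with pos show ?thesis
    using assms(1) by (simp add: real_integrable_def)
qed

lemma ext_mean_nonpos:
  assumes "\<And>x. 0 \<le> x \<Longrightarrow> u x \<le> 0"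
  shows "ext_mean M u \<le> 0"
proof -
  have "(\<integral>\<^sup>+x\<in>{0..}. ennreal (u x) \<partial>M) = (\<integral>\<^sup>+x. 0 \<partial>M)"
    by (rule nn_integral_cong) (use assms in \<open>auto simp: indicator_def ennreal_neg\<close>)
  then show ?thesis
    using enn2ereal_nonneg by (simp add: ext_mean_def zero_ennreal.rep_eq)
qed

text \<open>The function \<open>c - u\<close> is nonnegative almost surely and has expectation at
  most 0, hence vanishes almost surely.\<close>

lemma (in prob_space) AE_eq_of_expectation_ge:
  fixes u :: "'a \<Rightarrow> real"
  assumes "integrable M u" and "AE x in M. u x \<le> c" and "c \<le> expectation u"
  shows "AE x in M. u x = c"
proof -
  have int: "integrable M (\<lambda>x. c - u x)"
    using assms(1) by simp
  have nn: "AE x in M. 0 \<le> c - u x"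
    using assms(2) by simp
  have "expectation (\<lambda>x. c - u x) = c - expectation u"
    using assms(1) by (simp add: prob_space)
  then have "expectation (\<lambda>x. c - u x) = 0"
    using assms(3) integral_nonneg_AE[OF nn] by simp
  then show ?thesis
    by (subst (asm) integral_nonneg_eq_0_iff_AE[OF int nn]) (erule AE_mp, simp)
qed

section \<open>Real distributions with continuous cdf\<close>

text \<open>Links the measure in \<open>mixed_strategy\<close> to the one in
  \<open>expected_payoff\<close>: a real distribution is determined by its cdf.\<close>

lemma (in real_distribution) interval_measure_cdf: "interval_measure (cdf M) = M"
proof -
  have mono: "\<And>x y. x \<le> y \<Longrightarrow> cdf M x \<le> cdf M y"
    by (rule cdf_nondecreasing)
  note H = mono cdf_is_right_cont cdf_lim_at_bot
  show ?thesis
    by (rule cdf_unique[OF real_distribution_interval_measure[OF H cdf_lim_at_top_prob]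
          real_distribution_axioms cdf_interval_measure[OF H]])
qed

text \<open>Take for \<open>c\<close> the least point of the closed set where \<open>u = K\<close>
  at or above \<open>b\<close>. No mass lies strictly between \<open>b\<close> and \<open>c\<close>,
  and \<open>c\<close> is not an atom.\<close>

lemma (in real_distribution) cdf_gap:
  assumes cont: "continuous_on UNIV (cdf M)" and u: "continuous_on {b..} u"
    and AE: "AE x in M. u x = (K::real)" and lt: "cdf M b < 1"
  obtains c where "b \<le> c" and "u c = K" and "cdf M c = cdf M b"
proof -
  define S where "S = {x \<in> {b..}. u x = K}"
  have "closed S"
    unfolding S_def
    by (rule continuous_closed_preimage_constant[OF u]) simp
  \<comment> \<open>Otherwise all mass would lie to the left of \<open>b\<close>.\<close>
  have ne: "S \<noteq> {}"
  proof
    assume "S = {}"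
    then have "\<forall>x. u x = K \<longrightarrow> x < b"
      by (auto simp: S_def not_le)
    then have "AE x in M. x \<in> {..b}"
      using AE by (auto elim!: AE_mp intro: less_imp_le)
    then have "cdf M b = 1"
      by (simp add: cdf_def prob_eq_1)
    with lt show False by simp
  qed
  have bdd: "bdd_below S" by (auto simp: S_def)
  define c where "c = Inf S"
  have cS: "c \<in> S"
    unfolding c_def by (rule closed_contains_Inf[OF ne bdd \<open>closed S\<close>])
  have "AE x in M. x \<notin> {b<..<c}"
    using AE
  proof eventually_elim
    case (elim x)
    then show ?case
      using cInf_lower[OF _ bdd, of x] by (force simp: S_def c_def)
  qed
  then have "prob {b<..<c} = 0"
    by (simp add: prob_eq_0)
  moreover have "prob {c} = 0"
    using cont isCont_cdf by (simp add: continuous_on_eq_continuous_at)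
  ultimately have zero: "prob ({b<..<c} \<union> {c}) = 0"
    using measure_Un_le[of "{b<..<c}" M "{c}"] by (simp add: measure_le_0_iff)
  have "cdf M c = cdf M b"
  proof (cases "b < c")
    case True
    then have "{b<..c} = {b<..<c} \<union> {c}" by auto
    with zero cdf_diff_eq[OF True] show ?thesis by simp
  next
    case False
    with cS have "c = b" by (auto simp: S_def)
    then show ?thesis by simp
  qed
  with cS that show thesis by (auto simp: S_def)
qed

lemma mixed_strategyE:
  assumes "mixed_strategy (p, F)"
  obtains M where "real_distribution M" "interval_measure F = M" "F = cdf M" "AE x in M. 0 \<le> x"
    "continuous_on UNIV F" "0 \<le> p" "p \<le> 1" "\<forall>x\<le>0. F x = 0"
proof -
  from assms obtain M where M: "real_distribution M" "measure M {0..} = 1" "F = cdf M"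
    and cont: "continuous_on UNIV F" and p: "0 \<le> p" "p \<le> 1"
    by (auto simp: mixed_strategy_def)
  interpret real_distribution M by fact
  have AE: "AE x in M. 0 \<le> x"
    using M(2) prob_eq_1[of "{0..}"] by simp
  \<comment> \<open>Continuity of the cdf excludes an atom at 0, so the boundary case
    \<open>x = 0\<close> is covered too.\<close>
  have "prob {..x} = 0" if "x \<le> 0" for x
  proof -
    have "AE y in M. y \<noteq> 0"
      using cont isCont_cdf[of 0] prob_eq_0[of "{0}"] M(3)
      by (simp add: continuous_on_eq_continuous_at)
    then have "AE y in M. y \<notin> {..x}"
      using AE by eventually_elim (use that in auto)
    then show ?thesis
      by (simp add: prob_eq_0)
  qed
  then show thesis
    using M cont p AE interval_measure_cdf by (intro that[of M]) (auto simp: cdf_def)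
qed

lemma mixed_strategy_uniform:
  fixes a b :: real
  assumes "0 \<le> a" and "a < b"
  defines "M \<equiv> uniform_measure lborel {a..b}"
  shows "mixed_strategy (0, cdf M)" and "interval_measure (cdf M) = M" and "real_distribution M"
    and "AE x in M. a \<le> x \<and> x \<le> b"
proof -
  have pos: "emeasure lborel {a..b} \<noteq> 0" "emeasure lborel {a..b} \<noteq> \<infinity>"
    "emeasure lborel {a..b} < \<infinity>"
    using assms(2) by auto
  interpret prob_space M
    unfolding M_def by (rule prob_space_uniform_measure[OF pos(1,2)])
  show RD: "real_distribution M"
    by unfold_locales (simp add: M_def)
  interpret real_distribution M by (rule RD)
  show "interval_measure (cdf M) = M" by (rule interval_measure_cdf)
  show AE: "AE x in M. a \<le> x \<and> x \<le> b"
    unfolding M_def by (simp add: AE_uniform_measure[OF pos(1,3)])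
  have "AE x in M. x \<in> {0..}"
    using AE by eventually_elim (use assms(1) in auto)
  then have "prob {0..} = 1"
    by (subst prob_eq_1) auto
  moreover have "prob {x} = 0" for x
  proof -
    have "AE y in lborel. y \<noteq> x"
      by (rule AE_lborel_singleton)
    then have "AE y in M. y \<notin> {x}"
      unfolding M_def AE_uniform_measure[OF pos(1,3)] by eventually_elim auto
    then show ?thesis
      by (simp add: prob_eq_0)
  qed
  then have "continuous_on UNIV (cdf M)"
    by (simp add: continuous_on_eq_continuous_at isCont_cdf)
  ultimately show "mixed_strategy (0, cdf M)"
    using RD by (auto simp: mixed_strategy_def)
qed

text \<open>A continuous bid distribution cannot sit at a point \<open>b\<close>, but the uniform distribution on
  \<open>[b, b + \<epsilon>]\<close> approximates that pure bid.\<close>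

lemma le_of_ext_mean_le:
  fixes u :: "real \<Rightarrow> real"
  assumes u: "continuous_on {0..} u" "u \<in> borel_measurable borel" and b: "0 \<le> b"
    and le: "\<And>G. mixed_strategy (0, G) \<Longrightarrow> ext_mean (interval_measure G) u \<le> ereal c"
  shows "u b \<le> c"
proof (rule field_le_epsilon)
  fix e :: real assume "0 < e"
  then obtain d where d: "0 < d" "\<And>x. 0 \<le> x \<Longrightarrow> dist x b < d \<Longrightarrow> dist (u x) (u b) < e"
    using u(1) b unfolding continuous_on_iff by (metis atLeast_iff)
  \<comment> \<open>Starting at \<open>b\<close> keeps the support nonnegative; length
    \<open>d/2\<close> keeps it strictly within the continuity radius.\<close>
  define M where "M = uniform_measure lborel {b..b + d/2}"
  have "b < b + d/2" using d(1) by simp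
  note unif = mixed_strategy_uniform[OF b this, folded M_def]
  interpret real_distribution M by (rule unif(3))
  have AE: "AE x in M. \<bar>u x - u b\<bar> \<le> e"
    using unif(4)
  proof eventually_elim
    case (elim x)
    then show ?case using d(1) d(2)[of x] b by (auto simp: dist_real_def)
  qed
  have "integrable M u"
  proof (rule integrable_const_bound[where B = "\<bar>u b\<bar> + e"])
    show "AE x in M. norm (u x) \<le> \<bar>u b\<bar> + e"
      using AE by eventually_elim auto
  qed (use u(2) in simp)
  moreover have "AE x in M. 0 \<le> x"
    using unif(4) by eventually_elim (use b in simp)
  ultimately have "ext_mean M u = ereal (expectation u)"
    by (rule ext_mean_integrable)
  with le[OF unif(1)] unif(2) have "expectation u \<le> c"
    by simp
  moreover have "u b - e \<le> expectation u"
    by (rule integral_ge_const[OF \<open>integrable M u\<close>]) (use AE in \<open>eventually_elim, auto\<close>)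
  ultimately show "u b \<le> c + e" by simp
qed

section \<open>Payoffs against a common strategy\<close>

lemma expected_payoff_eq:
  "expected_payoff N V g r1 r2 i s \<beta> =
     ereal (1 - fst s) * ext_mean (interval_measure (snd s)) (payoff N V g r1 r2 \<beta> i)"
  by (simp add: expected_payoff_def ext_mean_def)

locale auction =
  fixes N :: nat and V g r1 r2 :: real
  assumes N: "2 \<le> N" and V: "g < V" and g: "0 < g"
    and r1: "0 \<le> r1" and r2: "0 \<le> r2" and r12: "r1 \<noteq> 0 \<or> r2 \<noteq> 0"
begin

text \<open>\<open>odds b\<close> is the probability of winning that makes the bid \<open>b\<close> worth \<open>0\<close>.\<close>

definition odds :: "real \<Rightarrow> real" where
  "odds b = (r1 * g + r2 * b) / (V - g - b + r1 * g + r2 * b)"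

text \<open>The winning probability is collected so that its coefficient is the denominator of
  \<open>odds\<close>.\<close>

definition bid_payoff :: "real \<Rightarrow> (real \<Rightarrow> real) \<Rightarrow> real \<Rightarrow> real" where
  "bid_payoff p F b = (V - g - b + r1 * g + r2 * b) * (p + (1 - p) * F b) ^ (N - 1)
     - (r1 * g + r2 * b)"

lemma payoff_eq:
  assumes "\<forall>j\<in>{1..N}. \<beta> j = (p, F)" and "i \<in> {1..N}"
  shows "payoff N V g r1 r2 \<beta> i = bid_payoff p F"
proof
  fix b
  have "win_prob N \<beta> i b = (\<Prod>j\<in>{1..N} - {i}. p + (1 - p) * F b)"
    unfolding win_prob_def by (rule prod.cong) (use assms in auto)
  also have "\<dots> = (p + (1 - p) * F b) ^ (N - 1)"
    using assms(2) by simp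
  finally show "payoff N V g r1 r2 \<beta> i b = bid_payoff p F b"
    by (simp add: payoff_def bid_payoff_def algebra_simps)
qed

lemma cost_nonneg: "0 \<le> b \<Longrightarrow> 0 \<le> r1 * g + r2 * b"
  using r1 r2 g by simp

text \<open>Here the assumption that \<open>r1\<close> and \<open>r2\<close> do not both vanish
  enters: losing with a positive bid costs something.\<close>

lemma cost_pos: "0 < b \<Longrightarrow> 0 < r1 * g + r2 * b"
  using r1 r2 g r12 by (metis add_nonneg_pos add_pos_nonneg less_eq_real_def mult_nonneg_nonneg
      mult_pos_pos)

lemma denom_pos: "0 \<le> b \<Longrightarrow> b \<le> V - g \<Longrightarrow> 0 < V - g - b + r1 * g + r2 * b"
  using cost_nonneg[of b] cost_pos[of b] V by (cases "b = 0") auto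

lemma odds_nonneg: "0 \<le> b \<Longrightarrow> b \<le> V - g \<Longrightarrow> 0 \<le> odds b"
  unfolding odds_def using denom_pos[of b] cost_nonneg[of b] by simp

lemma odds_top: "odds (V - g) = 1"
  unfolding odds_def using cost_pos[of "V - g"] V by simp

lemma odds_mono:
  assumes "0 \<le> a" "a \<le> b" "b \<le> V - g"
  shows "odds a \<le> odds b"
proof -
  \<comment> \<open>Cross-multiplying the two fractions cancels the product of the costs and leaves
    this inequality.\<close>
  have "(r1 * g + r2 * a) * (V - g - b) \<le> (r1 * g + r2 * b) * (V - g - a)"
    using assms cost_nonneg[of b] r2 by (intro mult_mono) (auto intro: mult_left_mono)
  then show ?thesis
    unfolding odds_def using denom_pos[of a] denom_pos[of b] assms
    by (simp add: divide_le_eq le_divide_eq algebra_simps)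
qed

lemma odds_le_1: "0 \<le> b \<Longrightarrow> b \<le> V - g \<Longrightarrow> odds b \<le> 1"
  using odds_mono[of b "V - g"] odds_top by simp

lemma odds_0_less_1: "odds 0 < 1"
  unfolding odds_def using V r1 g by (simp add: add_pos_nonneg)

lemma bid_payoff_le_0_iff:
  assumes "0 \<le> b" "b \<le> V - g"
  shows "bid_payoff p F b \<le> 0 \<longleftrightarrow> (p + (1 - p) * F b) ^ (N - 1) \<le> odds b"
    and "bid_payoff p F b = 0 \<longleftrightarrow> (p + (1 - p) * F b) ^ (N - 1) = odds b"
  using denom_pos[OF assms] by (auto simp: bid_payoff_def odds_def field_simps)

lemma power_root:
  assumes "0 \<le> x"
  shows "(x powr (1 / (real N - 1))) ^ (N - 1) = x" and "(x ^ (N - 1)) powr (1 / (real N - 1)) = x"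
proof -
  have *: "real (N - 1) = real N - 1" "N - 1 > 0"
    using N by auto
  show "(x powr (1 / (real N - 1))) ^ (N - 1) = x"
    \<comment> \<open>\<open>powr_realpow\<close> needs a positive base; the case 0 does occur, for
      \<open>odds 0\<close> when \<open>r1 = 0\<close>.\<close>
    by (cases "x = 0") (use assms * in \<open>auto simp flip: powr_realpow simp: powr_powr\<close>)
  show "(x ^ (N - 1)) powr (1 / (real N - 1)) = x"
    by (cases "x = 0") (use assms * in \<open>auto simp flip: powr_realpow simp: powr_powr\<close>)
qed

lemma continuous_bid_payoff:
  "continuous_on UNIV F \<Longrightarrow> continuous_on A (bid_payoff p F)"
  unfolding bid_payoff_def
  by (intro continuous_intros) (auto intro: continuous_on_subset)

text \<open>Supplies the upper bound required by \<open>integrable_of_ext_mean\<close>.\<close>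

lemma bid_payoff_le:
  assumes "0 \<le> p" "p \<le> 1" "0 \<le> F b" "F b \<le> 1" "0 \<le> b"
  shows "bid_payoff p F b \<le> V - g"
proof -
  define W where "W = (p + (1 - p) * F b) ^ (N - 1)"
  have "p + (1 - p) * F b \<le> p + (1 - p) * 1"
    using assms by (intro add_left_mono mult_left_mono) auto
  then have W: "0 \<le> W" "W \<le> 1"
    unfolding W_def using assms by (auto intro!: power_le_one)
  have "bid_payoff p F b = (V - g) * W - b * W - (r1 * g + r2 * b) * (1 - W)"
    by (simp add: bid_payoff_def W_def algebra_simps)
  also have "\<dots> \<le> (V - g) * 1 - 0 - 0"
    using W assms V cost_nonneg[of b] by (intro diff_mono mult_left_mono mult_nonneg_nonneg) auto
  finally show ?thesis by simp
qed

section \<open>The candidate strategy\<close>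

abbreviation "pst \<equiv> p_star N V g r1"
abbreviation "Fst \<equiv> F_star N V g r1 r2"

lemma p_star_eq: "pst = odds 0 powr (1 / (real N - 1))"
  by (simp add: p_star_def odds_def)

lemma p_star_bounds: "0 \<le> pst" "pst < 1"
proof -
  show "0 \<le> pst" by (simp add: p_star_eq)
  have "pst ^ (N - 1) < 1"
    using power_root(1)[of "odds 0"] odds_0_less_1 odds_nonneg[of 0] V by (simp add: p_star_eq)
  then show "pst < 1"
    by (metis linorder_not_le one_le_power)
qed

text \<open>Clamping the bid to \<open>[0, V - g]\<close> merges the three cases in the definition of \<open>F_star\<close>.\<close>

lemma F_star_eq:
  "Fst b = (odds (max 0 (min b (V - g))) powr (1 / (real N - 1)) - pst) / (1 - pst)"
proof -
  consider "b < 0" | "0 \<le> b" "b \<le> V - g" | "V - g < b" by linarith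
  then show ?thesis
  proof cases
    case 1
    then show ?thesis using V by (simp add: F_star_def p_star_eq)
  next
    case 2
    then show ?thesis by (simp add: F_star_def odds_def)
  next
    case 3
    then show ?thesis using V p_star_bounds odds_top by (simp add: F_star_def)
  qed
qed

lemma F_star_simps: "b \<le> 0 \<Longrightarrow> Fst b = 0" "V - g \<le> b \<Longrightarrow> Fst b = 1"
  using V p_star_bounds odds_top by (simp_all add: F_star_eq max_def min_def flip: p_star_eq)

lemma p_star_F_star:
  "0 \<le> b \<Longrightarrow> b \<le> V - g \<Longrightarrow> pst + (1 - pst) * Fst b = odds b powr (1 / (real N - 1))"
  using p_star_bounds by (simp add: F_star_eq)

lemma F_star_mono: "x \<le> y \<Longrightarrow> Fst x \<le> Fst y"
  unfolding F_star_eq using V p_star_bounds N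
  by (intro divide_right_mono diff_right_mono powr_mono2 odds_mono odds_nonneg) auto

lemma continuous_F_star: "continuous_on A Fst"
proof -
  have "continuous_on {0..V - g} odds"
    unfolding odds_def using denom_pos by (intro continuous_intros) force
  then have "continuous_on {0..V - g} (\<lambda>b. odds b powr (1 / (real N - 1)))"
    using N odds_nonneg by (intro continuous_on_powr' continuous_on_const) auto
  then have "continuous_on A (\<lambda>b. odds (max 0 (min b (V - g))) powr (1 / (real N - 1)))"
    by (rule continuous_on_compose2) (use V in \<open>auto intro!: continuous_intros\<close>)
  then have "continuous_on A (\<lambda>b. (odds (max 0 (min b (V - g))) powr (1 / (real N - 1)) - pst)
      / (1 - pst))"
    using p_star_bounds by (intro continuous_on_divide continuous_on_diff continuous_on_const) auto
  then show ?thesis by (simp add: F_star_eq[abs_def])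
qed

lemma F_star_distribution:
  "real_distribution (interval_measure Fst)" "cdf (interval_measure Fst) = Fst"
  "AE x in interval_measure Fst. 0 \<le> x \<and> x \<le> V - g"
proof -
  let ?M = "interval_measure Fst"
  have rc: "continuous (at_right a) Fst" for a
    using continuous_F_star[of UNIV]
    by (simp add: continuous_on_eq_continuous_at continuous_at_imp_continuous_at_within)
  have bot: "(Fst \<longlongrightarrow> 0) at_bot"
    by (rule tendsto_eventually, rule eventually_mono[OF eventually_le_at_bot[of 0]])
      (simp add: F_star_simps)
  have top: "(Fst \<longlongrightarrow> 1) at_top"
    by (rule tendsto_eventually, rule eventually_mono[OF eventually_ge_at_top[of "V - g"]])
      (simp add: F_star_simps)
  show RD: "real_distribution ?M"
    by (rule real_distribution_interval_measure[OF F_star_mono rc bot top])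
  show cdf: "cdf ?M = Fst"
    by (rule cdf_interval_measure[OF F_star_mono rc bot])
  interpret real_distribution ?M by (rule RD)
  have "prob {..0} = 0" "prob {..V - g} = 1"
    using fun_cong[OF cdf, of 0] fun_cong[OF cdf, of "V - g"]
    by (simp_all add: cdf_def F_star_simps)
  then have "AE x in ?M. x \<notin> {..0}" "AE x in ?M. x \<in> {..V - g}"
    by (simp_all add: prob_eq_0 prob_eq_1)
  then show "AE x in ?M. 0 \<le> x \<and> x \<le> V - g"
    by eventually_elim auto
qed

lemma mixed_strategy_star: "mixed_strategy (pst, Fst)"
proof -
  interpret real_distribution "interval_measure Fst" by (rule F_star_distribution)
  have "AE x in interval_measure Fst. x \<in> {0..}"
    using F_star_distribution(3) by eventually_elim auto
  then have "prob {0..} = 1"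
    by (subst prob_eq_1) auto
  then show ?thesis
    unfolding mixed_strategy_def
    using p_star_bounds continuous_F_star[of UNIV] F_star_distribution(1,2)
    by (auto intro!: exI[of _ "interval_measure Fst"])
qed

lemma bid_payoff_star:
  assumes "0 \<le> b"
  shows "bid_payoff pst Fst b \<le> 0" and "b \<le> V - g \<Longrightarrow> bid_payoff pst Fst b = 0"
proof -
  show eq: "bid_payoff pst Fst b = 0" if "b \<le> V - g"
    using assms that power_root(1)[OF odds_nonneg[OF assms that]]
    by (simp add: bid_payoff_le_0_iff p_star_F_star)
  show "bid_payoff pst Fst b \<le> 0"
  proof (cases "b \<le> V - g")
    \<comment> \<open>Such a bid wins surely but costs more than \<open>V - g\<close>.\<close>
    case False
    then show ?thesis by (simp add: bid_payoff_def F_star_simps)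
  qed (simp add: eq)
qed

lemma ext_mean_star: "ext_mean (interval_measure Fst) (bid_payoff pst Fst) = 0"
proof -
  let ?M = "interval_measure Fst"
  interpret real_distribution ?M by (rule F_star_distribution)
  have meas: "bid_payoff pst Fst \<in> borel_measurable borel"
    by (intro borel_measurable_continuous_onI continuous_bid_payoff continuous_F_star)
  have AE: "AE x in ?M. bid_payoff pst Fst x = 0"
    using F_star_distribution(3) by eventually_elim (simp add: bid_payoff_star)
  have "integrable ?M (bid_payoff pst Fst)"
    by (rule integrable_const_bound[where B = 0]) (use AE meas in auto)
  moreover have "AE x in ?M. 0 \<le> x"
    using F_star_distribution(3) by eventually_elim auto
  moreover have "expectation (bid_payoff pst Fst) = 0"
    by (rule integral_eq_zero_AE[OF AE])
  ultimately show ?thesis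
    by (simp add: ext_mean_integrable)
qed

lemma expected_payoff_star:
  assumes "\<forall>j\<in>{1..N}. \<beta> j = (pst, Fst)" and "i \<in> {1..N}"
  shows "expected_payoff N V g r1 r2 i (\<beta> i) \<beta> = 0"
  using assms ext_mean_star
  by (simp add: expected_payoff_eq payoff_eq[OF assms])

text \<open>No bid earns more than 0 against the candidate, so every deviation has value at most 0,
  which the candidate attains.\<close>

lemma nash_equilibrium_star:
  assumes "\<forall>j\<in>{1..N}. \<beta> j = (pst, Fst)"
  shows "nash_equilibrium N V g r1 r2 \<beta>"
  unfolding nash_equilibrium_def
proof (intro conjI ballI allI impI)
  fix i assume i: "i \<in> {1..N}"
  show "mixed_strategy (\<beta> i)"
    using assms i mixed_strategy_star by simp
  fix s assume s: "mixed_strategy s"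
  have "ereal (1 - fst s) * ext_mean (interval_measure (snd s)) (bid_payoff pst Fst) \<le> 0"
    using s ext_mean_nonpos[OF bid_payoff_star(1)]
    by (auto simp: mixed_strategy_def ereal_mult_le_0_iff)
  then show "expected_payoff N V g r1 r2 i s \<beta> \<le> expected_payoff N V g r1 r2 i (\<beta> i) \<beta>"
    unfolding expected_payoff_star[OF assms i]
    by (simp add: expected_payoff_eq payoff_eq[OF assms i])
qed

section \<open>Uniqueness\<close>

lemma eq_star_of_bid_payoff:
  assumes M: "mixed_strategy (p, F)" and p: "p < 1"
    and le: "\<And>b. 0 \<le> b \<Longrightarrow> bid_payoff p F b \<le> 0"
    and AE: "AE x in interval_measure F. bid_payoff p F x = 0"
  shows "p = pst" and "F = Fst"
proof -
  obtain M where M: "real_distribution M" "interval_measure F = M" "F = cdf M"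
    and cont: "continuous_on UNIV F" and p0: "0 \<le> p" and F0: "\<forall>x\<le>0. F x = 0"
    using mixed_strategyE[OF M] by blast
  interpret real_distribution M by fact
  have F: "0 \<le> F x" "F x \<le> 1" for x
    using M(3) cdf_nonneg cdf_bounded_prob by auto
  have H: "0 \<le> p + (1 - p) * F x" for x
    using p0 p F by simp
  define W where "W x = (p + (1 - p) * F x) ^ (N - 1)" for x
  have W: "W b = odds b" if b: "0 \<le> b" "b \<le> V - g" for b
  proof (rule ccontr)
    assume "W b \<noteq> odds b"
    moreover have "W b \<le> odds b"
      using le[OF b(1)] by (simp add: bid_payoff_le_0_iff[OF b] W_def)
    ultimately have lt: "W b < odds b" by simp
    then have "W b < 1"
      using odds_le_1[OF b] by simp
    then have "F b \<noteq> 1"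
      by (auto simp: W_def)
    then have "cdf M b < 1"
      using F[of b] M(3) by simp
    then obtain c where c: "b \<le> c" "bid_payoff p F c = 0" "cdf M c = cdf M b"
      using cdf_gap[of b "bid_payoff p F" 0] AE cont M continuous_bid_payoff by metis
    have Wc: "W c = W b"
      using c(3) M(3) by (simp add: W_def)
    show False
    proof (cases "c \<le> V - g")
      case True
      then have "W c = odds c"
        using c b by (simp add: bid_payoff_le_0_iff W_def)
      with odds_mono[OF b(1) c(1) True] Wc lt show False by simp
    next
      case False
      \<comment> \<open>Above \<open>V - g\<close> winning brings no gain, and losing has positive
        probability and positive cost, so the payoff cannot be 0.\<close>
      have "0 \<le> W c"
        using H by (simp add: W_def)
      then have "(V - g - c) * W c \<le> 0"
        using False by (simp add: mult_nonpos_nonneg)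
      moreover have "0 < (r1 * g + r2 * c) * (1 - W c)"
        using cost_pos[of c] False V Wc \<open>W b < 1\<close> by simp
      moreover have "bid_payoff p F c = (V - g - c) * W c - (r1 * g + r2 * c) * (1 - W c)"
        by (simp add: bid_payoff_def W_def algebra_simps)
      ultimately show False using c(2) by simp
    qed
  qed
  have root: "p + (1 - p) * F b = odds b powr (1 / (real N - 1))" if "0 \<le> b" "b \<le> V - g" for b
    using W[OF that] power_root(2)[OF H[of b]] by (simp add: W_def)
  \<comment> \<open>At bid 0 the cdf vanishes, so \<open>root\<close> isolates
    \<open>p\<close>.\<close>
  show p_eq: "p = pst"
    using root[of 0] F0[rule_format, of 0] V by (simp add: p_star_eq)
  have eq: "F b = Fst b" if "0 \<le> b" "b \<le> V - g" for b
  proof -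
    have "(1 - pst) * F b = (1 - pst) * Fst b"
      using root[OF that, unfolded p_eq] p_star_F_star[OF that] by linarith
    then show ?thesis using p_star_bounds by simp
  qed
  show "F = Fst"
  proof
    fix b
    consider "b < 0" | "0 \<le> b" "b \<le> V - g" | "V - g < b" by linarith
    then show "F b = Fst b"
    proof cases
      case 3
      then have "F (V - g) \<le> F b"
        using M(3) cdf_nondecreasing by simp
      with 3 eq[of "V - g"] F[of b] V show ?thesis by (simp add: F_star_simps)
    qed (use F0 eq in \<open>auto simp: F_star_simps\<close>)
  qed
qed

lemma symmetric_nash_equilibrium_imp_star:
  assumes nash: "nash_equilibrium N V g r1 r2 \<beta>" and sym: "symmetric_profile N \<beta>"
    and "i \<in> {1..N}"
  shows "\<beta> i = (pst, Fst)"
proof -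
  obtain p F where pF: "\<beta> 1 = (p, F)" by force
  have one: "1 \<in> {1..N}" using N by simp
  have \<beta>: "\<forall>j\<in>{1..N}. \<beta> j = (p, F)"
    using sym one pF unfolding symmetric_profile_def by metis
  have MS: "mixed_strategy (p, F)"
    using nash one pF unfolding nash_equilibrium_def by metis
  obtain M where M: "real_distribution M" "interval_measure F = M" "F = cdf M"
    and AE0: "AE x in M. 0 \<le> x"
    and cont: "continuous_on UNIV F" and p: "0 \<le> p" "p \<le> 1" and F0: "\<forall>x\<le>0. F x = 0"
    using mixed_strategyE[OF MS] by blast
  interpret real_distribution M by fact
  have F: "0 \<le> F x" "F x \<le> 1" for x
    using M(3) cdf_nonneg cdf_bounded_prob by auto
  define u where "u = bid_payoff p F"
  have u_cont: "continuous_on A u" for A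
    unfolding u_def by (rule continuous_bid_payoff[OF cont])
  have u_meas: "u \<in> borel_measurable borel"
    by (intro borel_measurable_continuous_onI u_cont)
  define U where "U = ereal (1 - p) * ext_mean M u"
  have dev: "ereal (1 - q) * ext_mean (interval_measure G) u \<le> U" if "mixed_strategy (q, G)" for q G
  proof -
    have "expected_payoff N V g r1 r2 1 (q, G) \<beta> \<le> expected_payoff N V g r1 r2 1 (\<beta> 1) \<beta>"
      using nash one that unfolding nash_equilibrium_def by blast
    then show ?thesis
      unfolding expected_payoff_eq payoff_eq[OF \<beta> one] pF fst_conv snd_conv M(2) U_def u_def .
  qed
  have dev0: "ext_mean (interval_measure G) u \<le> U" if "mixed_strategy (0, G)" for G
    using dev[OF that] by simp
  \<comment> \<open>Certain abstention is worth 0, since 0 times any \<open>ereal\<close> is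
    0.\<close>
  have "mixed_strategy (1, F)"
    using MS by (auto simp: mixed_strategy_def)
  from dev[OF this] have U0: "0 \<le> U" by (simp flip: zero_ereal_def)
  \<comment> \<open>If everyone abstained surely, a bid near 0 would win nearly
    \<open>V - g\<close>.\<close>
  have p1: "p < 1"
  proof (rule ccontr)
    assume "\<not> p < 1"
    with p have "p = 1" by simp
    then have "U = ereal 0" by (simp add: U_def flip: zero_ereal_def)
    then have "u 0 \<le> 0"
      using le_of_ext_mean_le[OF u_cont u_meas, of 0 0] dev0 by simp
    then show False using V \<open>p = 1\<close> by (simp add: u_def bid_payoff_def)
  qed
  have "integrable M u"
  proof (rule integrable_of_ext_mean[OF _ AE0])
    show "u x \<le> V - g" if "0 \<le> x" for x
      unfolding u_def using p F that by (intro bid_payoff_le) auto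
    show "ext_mean M u \<noteq> -\<infinity>"
      using U0 p1 by (auto simp: U_def)
  qed (use u_meas in simp)
  define m where "m = expectation u"
  have mean: "ext_mean M u = ereal m"
    unfolding m_def by (rule ext_mean_integrable[OF \<open>integrable M u\<close> AE0])
  have U: "U = ereal ((1 - p) * m)"
    by (simp add: U_def mean)
  have m0: "0 \<le> m"
    using U0 p1 U by (simp add: zero_le_mult_iff)
  \<comment> \<open>Deviation: keep the bid distribution but never abstain.\<close>
  have "mixed_strategy (0, F)"
    using MS by (auto simp: mixed_strategy_def)
  then have "m \<le> (1 - p) * m"
    using dev0[of F] M(2) mean U by simp
  with p(1) m0 have Um: "(1 - p) * m = m" and pm: "p = 0 \<or> m = 0"
    by (auto simp: algebra_simps mult_le_0_iff)
  have u_le: "u b \<le> m" if "0 \<le> b" for b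
    by (rule le_of_ext_mean_le[OF u_cont u_meas that]) (use dev0 U Um in simp)
  have u_AE: "AE x in M. u x = m"
    by (rule AE_eq_of_expectation_ge[OF \<open>integrable M u\<close>]) (use AE0 u_le m_def in auto)
  have "m = 0"
  proof (rule ccontr)
    assume "m \<noteq> 0"
    with pm have "p = 0" by simp
    have "cdf M 0 < 1"
      using F0[rule_format, of 0] M(3) by simp
    then obtain c where c: "0 \<le> c" "u c = m" "cdf M c = cdf M 0"
      using cdf_gap[of 0 u m] cont M(3) u_cont u_AE by metis
    then have "F c = 0"
      using F0[rule_format, of 0] M(3) by simp
    \<comment> \<open>With \<open>p = 0\<close> and \<open>N - 1 > 0\<close> the bid
      \<open>c\<close> wins with probability 0 and only incurs its cost.\<close>
    then have "u c \<le> 0"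
      using \<open>p = 0\<close> N cost_nonneg[OF c(1)] by (simp add: u_def bid_payoff_def power_0_left)
    with c(2) m0 \<open>m \<noteq> 0\<close> show False by simp
  qed
  then have "p = pst" "F = Fst"
    using eq_star_of_bid_payoff[OF MS p1] u_le u_AE M(2) by (auto simp: u_def)
  then show ?thesis
    using \<beta> assms(3) by simp
qed

end

theorem theorem3p3:
  fixes N :: nat and V g r1 r2 :: real
  assumes "N \<ge> 2"
    and "V > g" and "g > 0"
    and "r1 \<in> {0..1}" and "r2 \<in> {0..1}"
    and "r1 \<noteq> 0 \<or> r2 \<noteq> 0"
  shows "(\<forall>\<beta>. nash_equilibrium N V g r1 r2 \<beta> \<and> symmetric_profile N \<beta> \<longleftrightarrow>
            (\<forall>i\<in>{1..N}. \<beta> i = (p_star N V g r1, F_star N V g r1 r2))) \<and>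
         (\<forall>\<beta>. (\<forall>i\<in>{1..N}. \<beta> i = (p_star N V g r1, F_star N V g r1 r2)) \<longrightarrow>
            (\<forall>i\<in>{1..N}. expected_payoff N V g r1 r2 i (\<beta> i) \<beta> = 0))"
proof -
  interpret auction N V g r1 r2
    using assms by unfold_locales auto
  have "symmetric_profile N \<beta>" if "\<forall>i\<in>{1..N}. \<beta> i = (pst, Fst)" for \<beta>
    using that by (simp add: symmetric_profile_def)
  then show ?thesis
    using symmetric_nash_equilibrium_imp_star nash_equilibrium_star expected_payoff_star by blast
qed

end
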